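(* Consider a heterogeneous distributed storage system with nodes $U_1,\dots,U_n$, storage capacities $\alpha_i$, surviving sets $S_i^{(\ell)}$ ($\ell\in[\tau_i]$), repair download amounts $\beta(U_i,U_j,S_i^{(\ell)})$, and set of reconstruction sets $\mathscr{A}$. Define $$\mathscr{Q}=\min_{\substack{\mathcal{A}_t\in\mathscr{A}\\ |\mathcal{A}_t|=k_t}}\ \min_{\langle U_{\lambda_i}\rangle_{i=1}^{k_t}\in\mathscr{A}(\mathcal{A}_t)}\ \sum_{i=1}^{k_t}\min\left\{\alpha_{\lambda_i},\ \min_{\langle S_{\lambda_i}^{(\ell)}\rangle_{i=1}^{k_t}\in\mathscr{S}\left(\langle U_{\lambda_i}\rangle_{i=1}^{k_t}\right)}\ \sum_{\mu_j:\ U_{\mu_j}\in S_{\lambda_i}^{(\ell)}\setminus\{U_{\lambda_1},\ldots,U_{\lambda_{i-1}}\}}\beta\left(U_{\lambda_i},U_{\mu_j},S_{\lambda_i}^{(\ell)}\right)\right\}.$$ Then the bound $\min\text{cut-capacity}(s,D)\ge\mathscr{Q}$ is tight: there exist a reconstruction set $\mathcal{A}_t\in\mathscr{A}$, a node sequence $\langle U_{\lambda_i}^*\rangle_{i=1}^{k_t}\in\mathscr{A}(\mathcal{A}_t)$ and a surviving sequence $\langle S_{\lambda_i}^{(\ell^* )}\rangle_{i=1}^{k_t}$ associated with it such that the corresponding information flow graph, with source $s$ and data collector $D$, satisfies $\min\text{cut-capacity}(s,D)=\mathscr{Q}$.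
   Context: Write $[m]=\{1,\dots,m\}$. **Heterogeneous DSS.** There are $n$ nodes $U_1,\dots,U_n$; node $U_i$ has storage capacity $\alpha_i\ge 0$. A file is stored in encoded form on the nodes. There is a finite set $\mathscr{A}$ of reconstruction sets; each $\mathcal{A}_t\in\mathscr{A}$ is a set of $k_t=|\mathcal{A}_t|$ nodes holding sufficient packets to reconstruct the file ($k_t$ is the flexible reconstruction degree at time $t$). Each node $U_i$ has $\tau_i\ge1$ distinct surviving sets $S_i^{(1)},\dots,S_i^{(\tau_i)}\subseteq\{U_1,\dots,U_n\}\setminus\{U_i\}$: if $U_i$ fails, it can be replaced by a new node $U_i'$ (of the same capacity $\alpha_i$) generated by downloading $\beta(U_i,U_j,S_i^{(\ell)})>0$ packets from every node $U_j\in S_i^{(\ell)}$, for one choice of $\ell\in[\tau_i]$. **Sequences.** For $\mathcal{A}_t\in\mathscr{A}$, $\mathscr{A}(\mathcal{A}_t)$ is the set of all orderings $\langle U_{\lambda_i}\rangle_{i=1}^{k_t}$ of the (distinct) nodes of $\mathcal{A}_t$. For such a node sequence, $\mathscr{S}(\langle U_{\lambda_i}\rangle_{i=1}^{k_t})$ is the set of all surviving sequences $\langle S_{\lambda_i}^{(\ell)}\rangle_{i=1}^{k_t}$, where for each $i$ an index $\ell=\ell_i\in[\tau_{\lambda_i}]$ is chosen (independently for different $i$). **Information flow graph.** Given $\mathcal{A}_t\in\mathscr{A}$, a node sequence $\langle U_{\lambda_i}\rangle_{i=1}^{k_t}\in\mathscr{A}(\mathcal{A}_t)$ and a surviving sequence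 $\langle S_{\lambda_i}^{(\ell)}\rangle_{i=1}^{k_t}$, the information flow graph $\mathcal{G}=(\mathcal{V},\mathcal{E})$ is the following weighted directed acyclic graph. Step $-1$ contains the source $s$. Step $0$ contains vertices $In_i,Out_i$ for every $i\in[n]$, with an edge $(s,In_i)$ of infinite capacity and an edge $(In_i,Out_i)$ of capacity $\alpha_i$. For $j=1,\dots,k_t$, step $j$ (failure and repair of $U_{\lambda_j}$) contains vertices $In'_{\lambda_j},Out'_{\lambda_j}$ with an edge $(In'_{\lambda_j},Out'_{\lambda_j})$ of capacity $\alpha_{\lambda_j}$; and for every $U_\mu\in S_{\lambda_j}^{(\ell)}$ there is an edge of capacity $\beta(U_{\lambda_j},U_\mu,S_{\lambda_j}^{(\ell)})$ into $In'_{\lambda_j}$ from $Out'_\mu$ if $\mu\in\{\lambda_1,\dots,\lambda_{j-1}\}$, and from $Out_\mu$ otherwise. Step $k_t+1$ contains the data collector $D$, with edges $(Out'_{\lambda_j},D)$ of infinite capacity for all $j\in[k_t]$. **Cuts.** For $\mathcal{X}\subset\mathcal{V}$ with $s\in\mathcal{X}$ and $D\in\overline{\mathcal{X}}=\mathcal{V}\setminus\mathcal{X}$, $\text{cut-capacity}(\mathcal{X},\overline{\mathcal{X}})$ is the sum of capacities of all edges going from $\mathcal{X}$ to $\overline{\mathcal{X}}$, and $\min\text{cut-capacity}(s,D)$ is the minimum of $\text{cut-capacity}(\mathcal{X},\overline{\mathcal{X}})$ over all such $\mathcal{X}$.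
   Formalization: The formal theorem assumes that the bound min cut-capacity(s,D) ≥ Q holds for every information flow graph of the system; without this the claim is false, since a cut may pass through the capacity edge (In, Out) of a surviving helper node. *)

theory Defs
  imports
    "HOL-Library.Extended_Real"
    "HOL-Combinatorics.Multiset_Permutations"
    "Graph_Theory.Digraph"
begin

text \<open>
  Node \<open>U\<^sub>i\<close> is represented by its index \<open>i \<in> {1..n}\<close>; \<open>S i \<ell>\<close> for \<open>\<ell> \<in> {1..\<tau> i}\<close> are its
  surviving sets, \<open>\<beta> i j (S i \<ell>)\<close> is the amount downloaded from node \<open>j\<close> when node \<open>i\<close> is
  repaired with that surviving set, and \<open>R\<close> is the set of reconstruction sets.
\<close>

locale heterogeneous_dss =
  fixes n :: nat
    and \<alpha> :: "nat \<Rightarrow> real"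
    and \<tau> :: "nat \<Rightarrow> nat"
    and S :: "nat \<Rightarrow> nat \<Rightarrow> nat set"
    and \<beta> :: "nat \<Rightarrow> nat \<Rightarrow> nat set \<Rightarrow> real"
    and R :: "nat set set"
  assumes capacity_nonneg: "i \<in> {1..n} \<Longrightarrow> \<alpha> i \<ge> 0"
    and surviving_count_pos: "i \<in> {1..n} \<Longrightarrow> \<tau> i \<ge> 1"
    and surviving_distinct: "i \<in> {1..n} \<Longrightarrow> inj_on (S i) {1..\<tau> i}"
    and surviving_subset: "i \<in> {1..n} \<Longrightarrow> l \<in> {1..\<tau> i} \<Longrightarrow> S i l \<subseteq> {1..n} - {i}"
    and download_pos:
      "i \<in> {1..n} \<Longrightarrow> l \<in> {1..\<tau> i} \<Longrightarrow> j \<in> S i l \<Longrightarrow> \<beta> i j (S i l) > 0"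
    and reconstruction_finite: "finite R"
    and reconstruction_nonempty: "R \<noteq> {}"
    and reconstruction_subset: "A \<in> R \<Longrightarrow> A \<subseteq> {1..n}"

text \<open>
  The orderings of a reconstruction set \<open>A\<close> are the elements of \<^const>\<open>permutations_of_set\<close>
  \<open>A\<close>. Lists are indexed from \<open>0\<close>, so the predecessors of \<open>us ! i\<close> are \<open>set (take i us)\<close>.
\<close>

definition surviving_sequences ::
    "(nat \<Rightarrow> nat) \<Rightarrow> (nat \<Rightarrow> nat \<Rightarrow> nat set) \<Rightarrow> nat list \<Rightarrow> nat set list set" where
  "surviving_sequences \<tau> S us =
     {Ss. length Ss = length us \<and>
          (\<forall>i<length us. \<exists>l\<in>{1..\<tau> (us ! i)}. Ss ! i = S (us ! i) l)}"

definition Q_bound ::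
    "(nat \<Rightarrow> real) \<Rightarrow> (nat \<Rightarrow> nat) \<Rightarrow> (nat \<Rightarrow> nat \<Rightarrow> nat set) \<Rightarrow>
     (nat \<Rightarrow> nat \<Rightarrow> nat set \<Rightarrow> real) \<Rightarrow> nat set set \<Rightarrow> real" where
  "Q_bound \<alpha> \<tau> S \<beta> R =
     (MIN A\<in>R. MIN us\<in>permutations_of_set A.
        \<Sum>i<length us.
          min (\<alpha> (us ! i))
              (MIN Ss\<in>surviving_sequences \<tau> S us.
                 \<Sum>\<mu>\<in>Ss ! i - set (take i us). \<beta> (us ! i) \<mu> (Ss ! i)))"

datatype vertex = Source | In nat | Out nat | In' nat | Out' nat | Collector

text \<open>An arc is a triple (tail, capacity, head).\<close>

type_synonym flow_network = "(vertex, vertex \<times> ereal \<times> vertex) pre_digraph"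

definition arc_capacity :: "vertex \<times> ereal \<times> vertex \<Rightarrow> ereal" where
  "arc_capacity e = fst (snd e)"

definition flow_graph ::
    "nat \<Rightarrow> (nat \<Rightarrow> real) \<Rightarrow> (nat \<Rightarrow> nat \<Rightarrow> nat set \<Rightarrow> real) \<Rightarrow> nat list \<Rightarrow> nat set list \<Rightarrow>
     flow_network" where
  "flow_graph n \<alpha> \<beta> us Ss =
     \<lparr>verts = {Source, Collector} \<union> In ` {1..n} \<union> Out ` {1..n} \<union> In' ` set us \<union> Out' ` set us,
      arcs =
        {(Source, \<infinity>, In i) | i. i \<in> {1..n}} \<union>
        {(In i, ereal (\<alpha> i), Out i) | i. i \<in> {1..n}} \<union>
        {(In' (us ! j), ereal (\<alpha> (us ! j)), Out' (us ! j)) | j. j < length us} \<union>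
        {(if \<mu> \<in> set (take j us) then Out' \<mu> else Out \<mu>,
          ereal (\<beta> (us ! j) \<mu> (Ss ! j)), In' (us ! j)) | j \<mu>. j < length us \<and> \<mu> \<in> Ss ! j} \<union>
        {(Out' (us ! j), \<infinity>, Collector) | j. j < length us},
      tail = (\<lambda>e. fst e),
      head = (\<lambda>e. snd (snd e))\<rparr>"

definition cut_capacity ::
    "('v, 'e) pre_digraph \<Rightarrow> ('e \<Rightarrow> ereal) \<Rightarrow> 'v set \<Rightarrow> ereal" where
  "cut_capacity G c X = (\<Sum>e\<in>{e \<in> arcs G. tail G e \<in> X \<and> head G e \<in> verts G - X}. c e)"

definition min_cut_capacity ::
    "('v, 'e) pre_digraph \<Rightarrow> ('e \<Rightarrow> ereal) \<Rightarrow> 'v \<Rightarrow> 'v \<Rightarrow> ereal" where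
  "min_cut_capacity G c s d =
     (MIN X\<in>{X. X \<subseteq> verts G \<and> s \<in> X \<and> d \<in> verts G - X}. cut_capacity G c X)"

text \<open>
  That \<open>Q_bound\<close> is a lower bound for the minimum cut of every information flow graph does not
  follow from the axioms of \<^locale>\<open>heterogeneous_dss\<close>, because a cut may pass through an arc
  \<open>(In \<mu>, Out \<mu>)\<close> of a helper node. For example, with \<open>n = 3\<close>, all \<open>\<alpha> i = 1\<close>, all
  \<open>\<tau> i = 1\<close>, \<open>S 1 1 = S 2 1 = {3}\<close>, \<open>S 3 1 = {1}\<close>, all \<open>\<beta> = 1\<close> and \<open>R = {{1, 2}}\<close> one gets
  \<open>Q_bound = 2\<close>, while both flow graphs have a cut of capacity \<open>1\<close>, namely through
  \<open>(In 3, Out 3)\<close>. The statement that the bound is tight therefore takes the bound itself as a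
  premise.
\<close>

end

theory Submission
  imports Defs
begin

text \<open>
  Take a reconstruction set and an ordering \<open>us\<close> that minimise the sum in \<open>Q_bound\<close>. The
  surviving sets are chosen independently, so a single surviving sequence attains the inner
  minimum for all \<open>i\<close> simultaneously. In the resulting flow graph, put \<open>Collector\<close> and all
  \<open>Out' (us ! i)\<close> on the collector side, together with \<open>In' (us ! i)\<close> whenever the repair
  download of \<open>us ! i\<close> from nodes that have not failed before is below its capacity. This cut has
  capacity \<open>Q_bound\<close>.
\<close>

text \<open>The inner sum of \<open>Q_bound\<close>, with the surviving set as an argument: for
  fixed \<open>us\<close> and \<open>i\<close> it depends on a surviving sequence only through its
  \<open>i\<close>-th entry.\<close>

definition fresh_download ::
    "(nat \<Rightarrow> nat \<Rightarrow> nat set \<Rightarrow> real) \<Rightarrow> nat list \<Rightarrow> nat \<Rightarrow> nat set \<Rightarrow> real" where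
  "fresh_download \<beta> us i T = (\<Sum>\<mu>\<in>T - set (take i us). \<beta> (us ! i) \<mu> T)"

lemma finite_surviving_sequences: "finite (surviving_sequences \<tau> S us)"
proof (rule finite_subset)
  let ?U = "\<Union>u\<in>set us. S u ` {1..\<tau> u}"
  show "surviving_sequences \<tau> S us \<subseteq> {Ss. set Ss \<subseteq> ?U \<and> length Ss = length us}"
    by (fastforce simp: surviving_sequences_def in_set_conv_nth)
  show "finite {Ss. set Ss \<subseteq> ?U \<and> length Ss = length us}"
    by (rule finite_lists_length_eq) simp
qed

text \<open>Since \<open>f i\<close> sees only entry \<open>i\<close> and the entries range
  independently, minimisers chosen position by position form one admissible sequence that works for
  all \<open>i\<close>.\<close>

lemma surviving_sequence_minimizing:
  fixes f :: "nat \<Rightarrow> nat set \<Rightarrow> real"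
  assumes "\<And>u. u \<in> set us \<Longrightarrow> \<tau> u \<ge> 1"
  obtains Ts where "Ts \<in> surviving_sequences \<tau> S us"
    and "\<And>i. i < length us \<Longrightarrow> (MIN Ss\<in>surviving_sequences \<tau> S us. f i (Ss ! i)) = f i (Ts ! i)"
proof -
  have "\<exists>T\<in>S (us ! i) ` {1..\<tau> (us ! i)}. \<forall>T'\<in>S (us ! i) ` {1..\<tau> (us ! i)}. f i T \<le> f i T'"
    if "i < length us" for i
    \<comment> \<open>The candidate surviving sets at position \<open>i\<close> form a finite image,
      nonempty because \<open>\<tau> (us ! i) \<ge> 1\<close>, so a minimiser exists.\<close>
    using assms[of "us ! i"] that
    by (intro bexI[of _ "arg_min_on (f i) (S (us ! i) ` {1..\<tau> (us ! i)})"] ballI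
        arg_min_least arg_min_if_finite) auto
  then obtain T where T: "\<And>i. i < length us \<Longrightarrow> T i \<in> S (us ! i) ` {1..\<tau> (us ! i)}"
    and T_le: "\<And>i T'. i < length us \<Longrightarrow> T' \<in> S (us ! i) ` {1..\<tau> (us ! i)} \<Longrightarrow> f i (T i) \<le> f i T'"
    by metis
  let ?Ts = "map T [0..<length us]"
  have mem: "?Ts \<in> surviving_sequences \<tau> S us"
    using T by (fastforce simp: surviving_sequences_def)
  show thesis
  proof (rule that[OF mem])
    fix i assume i: "i < length us"
    show "(MIN Ss\<in>surviving_sequences \<tau> S us. f i (Ss ! i)) = f i (?Ts ! i)"
    proof (rule Min_eqI)
      show "finite ((\<lambda>Ss. f i (Ss ! i)) ` surviving_sequences \<tau> S us)"
        by (simp add: finite_surviving_sequences)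
      show "f i (?Ts ! i) \<in> (\<lambda>Ss. f i (Ss ! i)) ` surviving_sequences \<tau> S us"
        using mem by blast
      fix y assume "y \<in> (\<lambda>Ss. f i (Ss ! i)) ` surviving_sequences \<tau> S us"
      then show "f i (?Ts ! i) \<le> y"
        using i T_le by (fastforce simp: surviving_sequences_def)
    qed
  qed
qed

lemma min_cut_capacity_le:
  assumes "finite (verts G)" "X \<subseteq> verts G" "s \<in> X" "d \<in> verts G - X"
  shows "min_cut_capacity G c s d \<le> cut_capacity G c X"
  unfolding min_cut_capacity_def using assms by (intro Min_le) auto

text \<open>An explicit cut of exactly this capacity gives the bound, for any choice of surviving
  sets inside \<open>{1..n}\<close>. That inclusion makes the sets finite and ensures that every
  helper's \<open>Out\<close> vertex lies in the graph.\<close>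

lemma min_cut_flow_graph_le:
  assumes dist: "distinct us" and us: "set us \<subseteq> {1..n}"
    and Ts: "\<And>i. i < length us \<Longrightarrow> Ts ! i \<subseteq> {1..n}"
  shows "min_cut_capacity (flow_graph n \<alpha> \<beta> us Ts) arc_capacity Source Collector
    \<le> ereal (\<Sum>i<length us. min (\<alpha> (us ! i)) (fresh_download \<beta> us i (Ts ! i)))"
proof -
  define G where "G = flow_graph n \<alpha> \<beta> us Ts"
  define d where "d i = fresh_download \<beta> us i (Ts ! i)" for i
  \<comment> \<open>On \<open>I\<close> the minimum is the download \<open>d i\<close>; on the
    complement \<open>J\<close>, which includes ties, it is the capacity.\<close>
  define I where "I = {i. i < length us \<and> d i < \<alpha> (us ! i)}"
  define J where "J = {..<length us} - I"
  define Y where "Y = {Collector} \<union> Out' ` set us \<union> (\<lambda>i. In' (us ! i)) ` I"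
  define N where "N i = Ts ! i - set (take i us)" for i
  define store where
    "store i = (In' (us ! i), ereal (\<alpha> (us ! i)), Out' (us ! i))" for i
  \<comment> \<open>The tail \<open>Out \<mu>\<close> is correct only for helpers that have not
    failed before, so \<open>fetch\<close> is applied to pairs from
    \<open>Sigma I N\<close>.\<close>
  define fetch where
    "fetch = (\<lambda>(i, \<mu>). (Out \<mu>, ereal (\<beta> (us ! i) \<mu> (Ts ! i)), In' (us ! i)))"
  let ?X = "verts G - Y"
  have nth_eq: "us ! i = us ! j \<longleftrightarrow> i = j" if "i < length us" "j < length us" for i j
    using dist that by (simp add: nth_eq_iff_index_eq)
  have fin: "finite I" "finite J" "I \<union> J = {..<length us}" "I \<inter> J = {}"
    by (auto simp: I_def J_def)
  have lt: "i < length us" if "i \<in> I \<or> i \<in> J" for i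
    using that by (auto simp: I_def J_def)
  have finN: "finite (N i)" if "i \<in> I" for i
    using Ts[of i] lt[of i] that by (auto simp: N_def intro: finite_subset)
  have In'_Y: "In' (us ! i) \<in> Y \<longleftrightarrow> i \<in> I" if "i < length us" for i
    using that nth_eq lt by (auto simp: Y_def)
  have take_sub: "\<mu> \<in> set us" if "\<mu> \<in> set (take i us)" for i \<mu>
    using that by (rule in_set_takeD)
  have Y: "Y \<subseteq> verts G"
    using lt by (auto simp: Y_def G_def flow_graph_def)
  \<comment> \<open>No infinite arc crosses: those from \<open>Source\<close> end outside
    \<open>Y\<close>, and those into \<open>Collector\<close> start in \<open>Y\<close>. Downloads
    from already repaired helpers also start in \<open>Y\<close>, which is why only the fresh
    helpers \<open>N i\<close> contribute.\<close>
  have cut: "{e \<in> arcs G. tail G e \<in> ?X \<and> head G e \<in> verts G - ?X} = store ` J \<union> fetch ` Sigma I N"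
    (is "?C = ?D")
  proof
    show "?C \<subseteq> ?D"
    proof
      fix e assume "e \<in> ?C"
      then have e: "e \<in> arcs G" "fst e \<notin> Y" "snd (snd e) \<in> Y"
        by (auto simp: G_def flow_graph_def)
      from e(1) consider
        i where "e = (Source, \<infinity>, In i)"
        | i where "e = (In i, ereal (\<alpha> i), Out i)"
        | j where "j < length us" "e = store j"
        | j \<mu> where "j < length us" "\<mu> \<in> Ts ! j" "\<mu> \<in> set (take j us)" "fst e = Out' \<mu>"
        | j \<mu> where "j < length us" "\<mu> \<in> Ts ! j" "\<mu> \<notin> set (take j us)" "e = fetch (j, \<mu>)"
        | j where "j < length us" "fst e = Out' (us ! j)"
        unfolding G_def flow_graph_def store_def fetch_def by (auto split: if_splits)
      then show "e \<in> ?D"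
      proof cases
        case 3
        then have "j \<in> J" using e(2) In'_Y[of j] by (auto simp: store_def J_def)
        with 3 show ?thesis by blast
      next
        case 4
        then show ?thesis using e(2) take_sub by (auto simp: Y_def)
      next
        case 5
        then have "j \<in> I" using e(3) In'_Y[of j] by (auto simp: fetch_def)
        with 5 have "(j, \<mu>) \<in> Sigma I N" by (auto simp: N_def)
        with 5 show ?thesis by blast
      qed (use e in \<open>auto simp: Y_def\<close>)
    qed
    have "store j \<in> ?C" if "j \<in> J" for j
      using that lt[of j] In'_Y[of j] fin(4)
      by (auto simp: G_def flow_graph_def store_def Y_def)
    moreover have "fetch (j, \<mu>) \<in> ?C" if j: "j \<in> I" "\<mu> \<in> N j" for j \<mu>
    proof -
      have "fetch (j, \<mu>) \<in> arcs G"
        using j lt[of j] by (force simp: G_def flow_graph_def fetch_def N_def)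
      moreover have "Out \<mu> \<in> ?X"
        using j lt[of j] Ts[of j] by (auto simp: G_def flow_graph_def N_def Y_def)
      moreover have "In' (us ! j) \<in> verts G - ?X"
        using j lt[of j] In'_Y[of j] Y by auto
      ultimately show ?thesis by (simp add: G_def flow_graph_def fetch_def)
    qed
    ultimately show "?D \<subseteq> ?C" by blast
  qed
  \<comment> \<open>Arcs form a set, so injectivity is what turns sums over arcs into sums over
    indices; it rests on \<open>us\<close> having no repetitions.\<close>
  have inj: "inj_on store J" "inj_on fetch (Sigma I N)"
    using nth_eq lt by (auto simp: inj_on_def store_def fetch_def)
  have "cut_capacity G arc_capacity ?X
      = sum arc_capacity (store ` J) + sum arc_capacity (fetch ` Sigma I N)"
    unfolding cut_capacity_def cut using fin finN
    by (intro sum.union_disjoint) (auto simp: store_def fetch_def)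
  also have "sum arc_capacity (store ` J) = ereal (\<Sum>i\<in>J. \<alpha> (us ! i))"
    unfolding sum.reindex[OF inj(1)] by (simp add: store_def arc_capacity_def)
  also have "(\<Sum>i\<in>J. \<alpha> (us ! i)) = (\<Sum>i\<in>J. min (\<alpha> (us ! i)) (d i))"
    by (intro sum.cong) (auto simp: J_def I_def)
  also have "sum arc_capacity (fetch ` Sigma I N)
      = ereal (\<Sum>(i, \<mu>)\<in>Sigma I N. \<beta> (us ! i) \<mu> (Ts ! i))"
    unfolding sum.reindex[OF inj(2)] by (simp add: fetch_def arc_capacity_def case_prod_unfold)
  also have "(\<Sum>(i, \<mu>)\<in>Sigma I N. \<beta> (us ! i) \<mu> (Ts ! i)) = (\<Sum>i\<in>I. d i)"
    unfolding d_def fresh_download_def N_def[symmetric] using fin finN by (simp add: sum.Sigma)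
  also have "(\<Sum>i\<in>I. d i) = (\<Sum>i\<in>I. min (\<alpha> (us ! i)) (d i))"
    by (intro sum.cong) (auto simp: I_def)
  also have "ereal (\<Sum>i\<in>J. min (\<alpha> (us ! i)) (d i)) + ereal (\<Sum>i\<in>I. min (\<alpha> (us ! i)) (d i))
      = ereal (\<Sum>i<length us. min (\<alpha> (us ! i)) (d i))"
    using fin by (metis add.commute plus_ereal.simps(1) sum.union_disjoint)
  finally have "cut_capacity G arc_capacity ?X = \<dots>" .
  moreover have "min_cut_capacity G arc_capacity Source Collector
      \<le> cut_capacity G arc_capacity ?X"
    by (rule min_cut_capacity_le) (auto simp: G_def flow_graph_def Y_def)
  ultimately show ?thesis by (simp add: G_def d_def)
qed

theorem mainTheorem2:
  fixes n :: nat
    and \<alpha> :: "nat \<Rightarrow> real"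
    and \<tau> :: "nat \<Rightarrow> nat"
    and S :: "nat \<Rightarrow> nat \<Rightarrow> nat set"
    and \<beta> :: "nat \<Rightarrow> nat \<Rightarrow> nat set \<Rightarrow> real"
    and R :: "nat set set"
  assumes dss: "heterogeneous_dss n \<alpha> \<tau> S \<beta> R"
    and bound: "\<forall>A\<in>R. \<forall>us\<in>permutations_of_set A. \<forall>Ss\<in>surviving_sequences \<tau> S us.
      min_cut_capacity (flow_graph n \<alpha> \<beta> us Ss) arc_capacity Source Collector
        \<ge> ereal (Q_bound \<alpha> \<tau> S \<beta> R)"
  shows "\<exists>A\<in>R. \<exists>us\<in>permutations_of_set A. \<exists>Ss\<in>surviving_sequences \<tau> S us.
      min_cut_capacity (flow_graph n \<alpha> \<beta> us Ss) arc_capacity Source Collector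
        = ereal (Q_bound \<alpha> \<tau> S \<beta> R)"
proof -
  interpret heterogeneous_dss n \<alpha> \<tau> S \<beta> R by (fact dss)
  \<comment> \<open>The cost of an ordering; \<open>Q_bound\<close> is its minimum over all
    orderings of all reconstruction sets, attained because these families are finite and
    nonempty.\<close>
  define h where "h us = (\<Sum>i<length us. min (\<alpha> (us ! i))
    (MIN Ss\<in>surviving_sequences \<tau> S us. fresh_download \<beta> us i (Ss ! i)))" for us
  have finA: "finite A" if "A \<in> R" for A
    using reconstruction_subset[OF that] finite_subset by blast
  have Q: "Q_bound \<alpha> \<tau> S \<beta> R = (MIN A\<in>R. MIN us\<in>permutations_of_set A. h us)"
    by (simp add: Q_bound_def h_def fresh_download_def)
  have "Q_bound \<alpha> \<tau> S \<beta> R \<in> (\<lambda>A. MIN us\<in>permutations_of_set A. h us) ` R"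
    unfolding Q using reconstruction_finite reconstruction_nonempty by (intro Min_in) auto
  then obtain A where A: "A \<in> R" "Q_bound \<alpha> \<tau> S \<beta> R = (MIN us\<in>permutations_of_set A. h us)"
    by blast
  have "Q_bound \<alpha> \<tau> S \<beta> R \<in> h ` permutations_of_set A"
    unfolding A(2) using finA[OF A(1)] by (intro Min_in) auto
  then obtain us where us: "us \<in> permutations_of_set A" "Q_bound \<alpha> \<tau> S \<beta> R = h us"
    by blast
  have us_sub: "set us \<subseteq> {1..n}" "distinct us"
    using us(1) reconstruction_subset[OF A(1)] by (auto simp: permutations_of_set_def)
  obtain Ts where Ts: "Ts \<in> surviving_sequences \<tau> S us"
    and Ts_min: "\<And>i. i < length us \<Longrightarrow>
      (MIN Ss\<in>surviving_sequences \<tau> S us. fresh_download \<beta> us i (Ss ! i))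
        = fresh_download \<beta> us i (Ts ! i)"
    using surviving_sequence_minimizing[of us \<tau> S "fresh_download \<beta> us"]
      surviving_count_pos us_sub(1) by blast
  have "Ts ! i \<subseteq> {1..n}" if i: "i < length us" for i
  proof -
    obtain l where "l \<in> {1..\<tau> (us ! i)}" "Ts ! i = S (us ! i) l"
      using Ts i by (auto simp: surviving_sequences_def)
    moreover have "us ! i \<in> {1..n}"
      using i us_sub(1) nth_mem by blast
    ultimately show ?thesis
      using surviving_subset by blast
  qed
  then have "min_cut_capacity (flow_graph n \<alpha> \<beta> us Ts) arc_capacity Source Collector
      \<le> ereal (\<Sum>i<length us. min (\<alpha> (us ! i)) (fresh_download \<beta> us i (Ts ! i)))"
    using us_sub by (intro min_cut_flow_graph_le)
  also have "\<dots> = ereal (Q_bound \<alpha> \<tau> S \<beta> R)"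
    by (simp add: us(2) h_def Ts_min)
  \<comment> \<open>The explicit cut gives one inequality and the premise \<open>bound\<close> the
    other.\<close>
  finally show ?thesis
    using bound A(1) us(1) Ts by (meson order.antisym)
qed

end
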